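(* Let $D\subset\mathbb{R}^2$ be an equilateral triangle (the closed region). For every real number $a\ge \frac{3+\sqrt5}{2}$, $D$ can be dissected in three similar parts whose areas have ratio $1:1:a$. That is, there exist compact sets $X_1,X_2,X_3\subset\mathbb{R}^2$ with $\overline{X_i^\circ}=X_i$ for $i=1,2,3$, which are pairwise similar (each is the image of each other one under a similarity of $\mathbb{R}^2$), such that $D=X_1\cup X_2\cup X_3$, $\mu_2(X_i\cap X_j)=0$ for $i\ne j$, and $\mu_2(X_1)=\mu_2(X_2)$, $\mu_2(X_3)=a\,\mu_2(X_1)$.
   Context: $\mu_2$ denotes two-dimensional Lebesgue measure; $X^\circ$ is the interior and $\overline{X}$ the closure of $X$. A similarity of $\mathbb{R}^2$ is a map $f:\mathbb{R}^2\to\mathbb{R}^2$ with $|f(x)-f(y)|=r|x-y|$ for all $x,y$, for some $r>0$ (reflections are allowed). *)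

theory Defs
  imports "HOL-Analysis.Analysis"
begin

definition similarity :: "('a::metric_space \<Rightarrow> 'a) \<Rightarrow> bool" where
  "similarity f \<longleftrightarrow> (\<exists>r>0. \<forall>x y. dist (f x) (f y) = r * dist x y)"

definition similar_sets :: "'a::metric_space set \<Rightarrow> 'a set \<Rightarrow> bool" where
  "similar_sets S T \<longleftrightarrow> (\<exists>f. similarity f \<and> T = f ` S)"

definition equilateral_triangle :: "(real ^ 2) set \<Rightarrow> bool" where
  "equilateral_triangle D \<longleftrightarrow>
     (\<exists>A B C. A \<noteq> B \<and> dist A B = dist B C \<and> dist B C = dist C A \<and> D = convex hull {A, B, C})"

end

theory Submission
  imports Defs
begin

text \<open>Let \<open>t = 1 / sqrt a\<close>, so that the hypothesis on \<open>a\<close> says \<open>t + t\<^sup>2 \<le> 1\<close>: \<open>t\<close> is at most the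
inverse of the golden ratio. It is enough to find a set \<open>X\<close> and two similarities \<open>f\<close>, \<open>g\<close> of ratio \<open>t\<close>
such that \<open>X\<close>, \<open>f X\<close>, \<open>g X\<close> dissect the triangle \<open>ABC\<close>, that is, to solve \<open>X = ABC - f X - g X\<close>.
If \<open>f\<close> and \<open>g\<close> map \<open>ABC\<close> to disjoint small triangles, the solution is an alternating
construction: remove the small triangles, put back their images under \<open>f\<close> and \<open>g\<close>, and so on.
That works for \<open>t \<le> 1/2\<close>.

For larger \<open>t\<close> take the small triangles at the corners \<open>A\<close> and \<open>B\<close>; they overlap in a triangle of
side \<open>2 t - 1\<close> in the middle of \<open>AB\<close> (in units of the side of \<open>ABC\<close>). The construction survives
if neither copy of \<open>X\<close> enters the overlap. To arrange this, \<open>f\<close> includes a rotation and \<open>g\<close> a reflection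
of the triangle: both map the corner \<open>A\<close> to the overlap, and they map \<open>C\<close> to \<open>A\<close> and \<open>B\<close>
respectively. The requirements then support each other. If \<open>X\<close> avoids corners of side
\<open>2 - 1/t\<close> at \<open>A\<close> and at \<open>B\<close>, its two copies are disjoint and stay away from the triangle
of side \<open>t\<close> at \<open>C\<close>; so \<open>X\<close> fills that triangle, and its copies fill corners of side \<open>t\<^sup>2\<close> at \<open>A\<close> and \<open>B\<close>. These contain the corners that \<open>X\<close> has to avoid,
since \<open>2 - 1/t \<le> t\<^sup>2\<close> is equivalent to \<open>t + t\<^sup>2 \<le> 1\<close>.

The open set \<open>tile\<close> is the solution obtained in this way, as a least fixed point. Disjointness is
\<open>tile_disjoint_shrink_tile\<close> and \<open>shrunk_tiles_disjoint\<close>; \<open>negligible_gap\<close> shows that tile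
and copies leave only a null set uncovered, because this set is contained, up to lines, in its two
copies and \<open>2 t\<^sup>2 < 1\<close>. By \<open>dissection_by_closures\<close> the closures of the three open sets are the
required parts.\<close>

section \<open>Similarities of Euclidean space\<close>

text \<open>Dividing by the ratio and moving the image of the origin back to the origin leaves an isometry that
fixes the origin. Surjectivity of similarities and their effect on Lebesgue measure both come from
this normal form.\<close>
lemma similarity_affine_form:
  fixes f :: "'a::euclidean_space \<Rightarrow> 'a"
  assumes "0 < r" and "\<And>x y. dist (f x) (f y) = r * dist x y"
  obtains g c where "orthogonal_transformation g" "f = (\<lambda>x. r *\<^sub>R g x + c)"
proof
  let ?g = "\<lambda>x. (f x - f 0) /\<^sub>R r"
  show "orthogonal_transformation ?g"
    unfolding orthogonal_transformation_isometry
  proof (intro conjI allI)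
    fix x y
    have "dist (?g x) (?g y) = norm ((f x - f y) /\<^sub>R r)"
      by (simp add: dist_norm flip: scaleR_diff_right)
    also have "\<dots> = dist (f x) (f y) / r"
      using assms(1) unfolding norm_scaleR dist_norm by (simp add: field_simps)
    also have "\<dots> = dist x y"
      using assms by simp
    finally show "dist (?g x) (?g y) = dist x y" .
  qed simp
  show "f = (\<lambda>x. r *\<^sub>R ?g x + f 0)"
    using assms(1) by simp
qed

lemma similarity_bij:
  fixes f :: "'a::euclidean_space \<Rightarrow> 'a"
  assumes "similarity f"
  shows "bij f"
proof -
  obtain r where r: "0 < r" "\<And>x y. dist (f x) (f y) = r * dist x y"
    using assms by (auto simp: similarity_def)
  obtain g c where g: "orthogonal_transformation g" and f: "f = (\<lambda>x. r *\<^sub>R g x + c)"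
    using similarity_affine_form [OF r] .
  have "inj f"
    using r by (metis dist_eq_0_iff injI less_irrefl mult_eq_0_iff)
  moreover have "y \<in> range f" for y
  proof -
    obtain x where "g x = (y - c) /\<^sub>R r"
      using orthogonal_transformation_surj [OF g] by (metis surjD)
    then have "f x = y"
      using r by (simp add: f)
    then show ?thesis by blast
  qed
  ultimately show ?thesis
    by (auto simp: bij_def)
qed

lemma similarity_inv:
  fixes f :: "'a::euclidean_space \<Rightarrow> 'a"
  assumes "similarity f"
  shows "similarity (inv f)"
proof -
  obtain r where r: "0 < r" "\<And>x y. dist (f x) (f y) = r * dist x y"
    using assms by (auto simp: similarity_def)
  have "f (inv f x) = x" for x
    using similarity_bij [OF assms] by (simp add: bij_is_surj surj_f_inv_f)
  then have "dist (inv f x) (inv f y) = (1 / r) * dist x y" for x y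
    using r(1) r(2) [of "inv f x" "inv f y"] by (simp add: field_simps)
  then show ?thesis
    using r(1) unfolding similarity_def by (intro exI [of _ "1 / r"]) simp
qed

lemma similarity_comp:
  assumes "similarity f" "similarity g"
  shows "similarity (f \<circ> g)"
proof -
  obtain r s where "0 < r" "\<And>x y. dist (f x) (f y) = r * dist x y"
    "0 < s" "\<And>x y. dist (g x) (g y) = s * dist x y"
    using assms by (auto simp: similarity_def)
  then show ?thesis
    unfolding similarity_def by (intro exI [of _ "r * s"]) simp
qed

lemma similar_sets_sym:
  fixes S T :: "'a::euclidean_space set"
  assumes "similar_sets S T"
  shows "similar_sets T S"
proof -
  obtain f where f: "similarity f" "T = f ` S"
    using assms by (auto simp: similar_sets_def)
  then have "S = inv f ` T"
    using similarity_bij [OF f(1)] by (simp add: bij_is_inj image_inv_f_f)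
  then show ?thesis
    using similarity_inv [OF f(1)] by (auto simp: similar_sets_def)
qed

lemma similar_sets_trans:
  assumes "similar_sets S T" "similar_sets T V"
  shows "similar_sets S V"
  using assms similarity_comp unfolding similar_sets_def by (metis image_comp)

lemma continuous_on_similarity:
  assumes "similarity f"
  shows "continuous_on S f"
proof -
  obtain r where r: "0 < r" "\<And>x y. dist (f x) (f y) = r * dist x y"
    using assms by (auto simp: similarity_def)
  show ?thesis
    unfolding continuous_on_iff
  proof (intro ballI allI impI)
    fix x and e :: real assume "0 < e"
    then show "\<exists>d>0. \<forall>x'\<in>S. dist x' x < d \<longrightarrow> dist (f x') (f x) < e"
      using r by (intro exI [of _ "e / r"]) (simp add: field_simps)
  qed
qed

lemma similarity_image_eq_vimage:
  fixes f :: "'a::euclidean_space \<Rightarrow> 'a"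
  assumes "similarity f"
  shows "f ` S = inv f -` S"
  using similarity_bij [OF assms] by (simp add: bij_vimage_eq_inv_image bij_imp_bij_inv inv_inv_eq)

lemma open_similarity_image:
  fixes f :: "'a::euclidean_space \<Rightarrow> 'a"
  assumes "similarity f" "open S"
  shows "open (f ` S)"
  using assms similarity_inv continuous_on_similarity
  by (metis similarity_image_eq_vimage open_vimage)

lemma closure_similarity_image:
  fixes f :: "'a::euclidean_space \<Rightarrow> 'a"
  assumes "similarity f"
  shows "closure (f ` S) = f ` closure S"
proof
  have "closed (f ` closure S)"
    using assms similarity_inv continuous_on_similarity
    by (metis similarity_image_eq_vimage closed_vimage closed_closure)
  then show "closure (f ` S) \<subseteq> f ` closure S"
    by (simp add: closure_minimal closure_subset image_mono)
  show "f ` closure S \<subseteq> closure (f ` S)"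
    by (rule image_closure_subset)
       (auto intro: continuous_on_similarity assms closure_subset [THEN subsetD])
qed

lemma
  fixes f :: "real^'n::{finite,wellorder} \<Rightarrow> real^'n::_"
  assumes "0 < r" and "\<And>x y. dist (f x) (f y) = r * dist x y" and S: "S \<in> lmeasurable"
  shows lmeasurable_similarity_image: "f ` S \<in> lmeasurable"
    and measure_similarity_image: "measure lebesgue (f ` S) = r ^ CARD('n) * measure lebesgue S"
proof -
  obtain g c where g: "orthogonal_transformation g" and f: "f = (\<lambda>x. r *\<^sub>R g x + c)"
    using similarity_affine_form [OF assms(1,2)] .
  have img: "f ` S = (\<lambda>x. r *\<^sub>R x + c) ` g ` S"
    by (auto simp: f)
  show "measure lebesgue (f ` S) = r ^ CARD('n) * measure lebesgue S"
    using assms(1) measure_lebesgue_affine [of r c "g ` S"] measure_orthogonal_image [OF g S]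
    by (simp add: img)
  have "f ` S = (+) c ` (*\<^sub>R) r ` g ` S"
    by (auto simp: f image_iff algebra_simps)
  moreover have "linear ((*\<^sub>R) r :: real^'n::_ \<Rightarrow> _)"
    by (simp add: linear_scaleR)
  ultimately show "f ` S \<in> lmeasurable"
    by (simp add: measurable_linear_image measurable_orthogonal_image g S measurable_translation)
qed

section \<open>From open to closed dissections\<close>

text \<open>Turns open pieces that fill \<^term>\<open>D\<close> up to a null set into closed ones. Density holds because an
open set that misses every piece is null, hence empty. A point common to two of the closures lies in
none of the open pieces: an open set that is disjoint from another one is disjoint from its closure.
So the closures overlap only in the null gap, and no separate argument is needed that the pieces
have null boundary, however fractal they are.\<close>
lemma dissection_by_closures:
  fixes D :: "'a::euclidean_space set" and V :: "'i \<Rightarrow> 'a set"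
  assumes "finite I" "closed D" and dense: "D \<subseteq> closure (interior D)"
    and opn: "\<And>i. i \<in> I \<Longrightarrow> open (V i)" and sub: "\<And>i. i \<in> I \<Longrightarrow> V i \<subseteq> D"
    and disj: "disjoint_family_on V I"
    and neg: "negligible (D - (\<Union>i\<in>I. V i))"
  shows "D = (\<Union>i\<in>I. closure (V i))"
    and "pairwise (\<lambda>i j. negligible (closure (V i) \<inter> closure (V j))) I"
proof -
  let ?V = "\<Union>i\<in>I. V i"
  have cl: "closure (V i) \<subseteq> D" if "i \<in> I" for i
    using sub [OF that] \<open>closed D\<close> by (simp add: closure_minimal)
  have "interior D - closure ?V = {}"
  proof (rule ccontr)
    assume "interior D - closure ?V \<noteq> {}"
    then have "\<not> negligible (interior D - closure ?V)"
      by (intro open_not_negligible) auto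
    moreover have "interior D - closure ?V \<subseteq> D - ?V"
      using interior_subset [of D] closure_subset [of ?V] by blast
    ultimately show False
      using neg negligible_subset by blast
  qed
  then have "D \<subseteq> closure ?V"
    using dense closure_minimal [of "interior D" "closure ?V"] by (metis Diff_eq_empty_iff closed_closure subset_trans)
  also have "closure ?V \<subseteq> (\<Union>i\<in>I. closure (V i))"
    using \<open>finite I\<close> by (intro closure_minimal closed_UN UN_mono closure_subset) auto
  finally show "D = (\<Union>i\<in>I. closure (V i))"
    using cl by blast
  show "pairwise (\<lambda>i j. negligible (closure (V i) \<inter> closure (V j))) I"
  proof (rule pairwiseI)
    fix i j assume ij: "i \<in> I" "j \<in> I" "i \<noteq> j"
    have avoid: "V k \<inter> closure (V l) = {}" if "k \<in> I" "l \<in> I" "k \<noteq> l" for k l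
      using that disj opn by (simp add: disjoint_family_on_def open_Int_closure_eq_empty)
    have "x \<notin> V k" if "x \<in> closure (V i) \<inter> closure (V j)" "k \<in> I" for x k
      using avoid [of k i] avoid [of k j] ij that by (cases "k = i") auto
    then have "closure (V i) \<inter> closure (V j) \<subseteq> D - ?V"
      using cl [OF ij(1)] by auto
    then show "negligible (closure (V i) \<inter> closure (V j))"
      using neg negligible_subset by blast
  qed
qed


section \<open>Barycentric coordinates of an equilateral triangle\<close>

locale equilateral_frame =
  fixes A B C :: "real^2" and s :: real
  assumes s_pos: "0 < s"
    and sides: "dist A B = s" "dist B C = s" "dist C A = s"
begin

definition wedge :: "real^2 \<Rightarrow> real^2 \<Rightarrow> real" where
  "wedge u v = u$1 * v$2 - u$2 * v$1"

definition pt :: "real \<Rightarrow> real \<Rightarrow> real \<Rightarrow> real^2" where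
  "pt a b c = a *\<^sub>R A + b *\<^sub>R B + c *\<^sub>R C"

text \<open>Cramer's rule gives the barycentric coordinates \<open>\<beta>\<close> and \<open>\<gamma>\<close>; \<open>\<alpha>\<close> makes the sum 1.\<close>
definition \<beta> :: "real^2 \<Rightarrow> real" where
  "\<beta> x = wedge (x - A) (C - A) / wedge (B - A) (C - A)"

definition \<gamma> :: "real^2 \<Rightarrow> real" where
  "\<gamma> x = wedge (B - A) (x - A) / wedge (B - A) (C - A)"

definition \<alpha> :: "real^2 \<Rightarrow> real" where
  "\<alpha> x = 1 - \<beta> x - \<gamma> x"

lemma inner_sides:
  "(B - A) \<bullet> (B - A) = s\<^sup>2" "(C - A) \<bullet> (C - A) = s\<^sup>2" "(B - A) \<bullet> (C - A) = s\<^sup>2 / 2"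
proof -
  show 1: "(B - A) \<bullet> (B - A) = s\<^sup>2"
    using sides(1) by (simp add: dist_norm norm_minus_commute flip: power2_norm_eq_inner)
  show 2: "(C - A) \<bullet> (C - A) = s\<^sup>2"
    using sides(3) by (simp add: dist_norm flip: power2_norm_eq_inner)
  have "B - C = (B - A) - (C - A)"
    by simp
  then have "((B - A) - (C - A)) \<bullet> ((B - A) - (C - A)) = s\<^sup>2"
    using sides(2) by (simp add: dist_norm flip: power2_norm_eq_inner)
  then show "(B - A) \<bullet> (C - A) = s\<^sup>2 / 2"
    unfolding inner_diff_left [of "B - A"] inner_diff_right [of _ "B - A"]
    using 1 2 by (simp add: inner_commute)
qed

lemma wedge_nonzero: "wedge (B - A) (C - A) \<noteq> 0"
proof -
  have "(wedge u v)\<^sup>2 = (u \<bullet> u) * (v \<bullet> v) - (u \<bullet> v)\<^sup>2" for u v :: "real^2"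
    by (simp add: wedge_def inner_vec_def sum_2 power2_eq_square algebra_simps)
  then have "(wedge (B - A) (C - A))\<^sup>2 = 3 / 4 * (s\<^sup>2)\<^sup>2"
    by (simp only: inner_sides) (simp add: power2_eq_square)
  moreover have "0 < 3 / 4 * (s\<^sup>2)\<^sup>2"
    using s_pos by simp
  ultimately show ?thesis
    by (metis less_irrefl zero_power2)
qed

lemma sum_coords: "\<alpha> x + \<beta> x + \<gamma> x = 1"
  by (simp add: \<alpha>_def)

lemma pt_coords: "pt (\<alpha> x) (\<beta> x) (\<gamma> x) = x"
proof -
  define d where "d = wedge (B - A) (C - A)"
  have d: "d \<noteq> 0"
    using wedge_nonzero by (simp add: d_def)
  have cramer: "d *\<^sub>R w = wedge w (C - A) *\<^sub>R (B - A) + wedge (B - A) w *\<^sub>R (C - A)" for w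
    by (simp add: d_def wedge_def vec_eq_iff forall_2 algebra_simps)
  have "x - A = (1 / d) *\<^sub>R (d *\<^sub>R (x - A))"
    using d by simp
  also have "\<dots> = \<beta> x *\<^sub>R (B - A) + \<gamma> x *\<^sub>R (C - A)"
    unfolding cramer by (simp add: \<beta>_def \<gamma>_def d_def scaleR_add_right)
  finally show ?thesis
    by (simp add: pt_def \<alpha>_def algebra_simps)
qed

lemma coords_pt [simp]:
  assumes "a + b + c = 1"
  shows "\<alpha> (pt a b c) = a" "\<beta> (pt a b c) = b" "\<gamma> (pt a b c) = c"
proof -
  have a: "a = 1 - b - c"
    using assms by simp
  have w: "pt a b c - A = b *\<^sub>R (B - A) + c *\<^sub>R (C - A)"
    by (simp add: pt_def a algebra_simps)
  have "wedge (pt a b c - A) (C - A) = b * wedge (B - A) (C - A)"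
    "wedge (B - A) (pt a b c - A) = c * wedge (B - A) (C - A)"
    unfolding w by (simp_all add: wedge_def algebra_simps)
  then show "\<beta> (pt a b c) = b" "\<gamma> (pt a b c) = c"
    using wedge_nonzero by (simp_all add: \<beta>_def \<gamma>_def)
  then show "\<alpha> (pt a b c) = a"
    by (simp add: \<alpha>_def a)
qed

text \<open>For an equilateral triangle the metric is a symmetric function of the three coordinate differences.
Permuting the barycentric coordinates is therefore an isometry, which is what makes the maps
of the construction similarities.\<close>
lemma dist_coords:
  "(dist x y)\<^sup>2 = s\<^sup>2 / 2 * ((\<alpha> x - \<alpha> y)\<^sup>2 + (\<beta> x - \<beta> y)\<^sup>2 + (\<gamma> x - \<gamma> y)\<^sup>2)"
proof -
  define b c where "b = \<beta> x - \<beta> y" and "c = \<gamma> x - \<gamma> y"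
  have "x - y = pt (\<alpha> x) (\<beta> x) (\<gamma> x) - pt (\<alpha> y) (\<beta> y) (\<gamma> y)"
    by (simp add: pt_coords)
  also have "\<dots> = b *\<^sub>R (B - A) + c *\<^sub>R (C - A)"
    by (simp add: pt_def \<alpha>_def b_def c_def algebra_simps)
  finally have "(dist x y)\<^sup>2 = (b *\<^sub>R (B - A) + c *\<^sub>R (C - A)) \<bullet> (b *\<^sub>R (B - A) + c *\<^sub>R (C - A))"
    by (simp add: dist_norm power2_norm_eq_inner)
  also have "\<dots> = b * b * ((B - A) \<bullet> (B - A)) + 2 * b * c * ((B - A) \<bullet> (C - A))
      + c * c * ((C - A) \<bullet> (C - A))"
    unfolding inner_add_left inner_add_right inner_scaleR_left inner_scaleR_right
      inner_commute [of "C - A" "B - A"] by (simp add: algebra_simps)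
  also have "\<dots> = s\<^sup>2 / 2 * ((- b - c)\<^sup>2 + b\<^sup>2 + c\<^sup>2)"
    unfolding inner_sides by (simp add: power2_eq_square algebra_simps)
  also have "- b - c = \<alpha> x - \<alpha> y"
    by (simp add: \<alpha>_def b_def c_def)
  finally show ?thesis
    by (simp add: b_def c_def)
qed

lemma triangle_coords: "convex hull {A, B, C} = {x. 0 \<le> \<alpha> x \<and> 0 \<le> \<beta> x \<and> 0 \<le> \<gamma> x}"
proof -
  have "convex hull {A, B, C} = {pt a b c |a b c. 0 \<le> a \<and> 0 \<le> b \<and> 0 \<le> c \<and> a + b + c = 1}"
    by (simp add: convex_hull_3 pt_def)
  also have "\<dots> = {x. 0 \<le> \<alpha> x \<and> 0 \<le> \<beta> x \<and> 0 \<le> \<gamma> x}"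
  proof (intro set_eqI iffI)
    fix x assume "x \<in> {x. 0 \<le> \<alpha> x \<and> 0 \<le> \<beta> x \<and> 0 \<le> \<gamma> x}"
    moreover have "x = pt (\<alpha> x) (\<beta> x) (\<gamma> x)"
      by (simp add: pt_coords)
    ultimately show "x \<in> {pt a b c |a b c. 0 \<le> a \<and> 0 \<le> b \<and> 0 \<le> c \<and> a + b + c = 1}"
      using sum_coords [of x] by blast
  qed auto
  finally show ?thesis .
qed

lemma continuous_on_coords [continuous_intros]:
  "continuous_on S \<alpha>" "continuous_on S \<beta>" "continuous_on S \<gamma>"
proof -
  show \<beta>: "continuous_on S \<beta>" and \<gamma>: "continuous_on S \<gamma>"
    unfolding \<beta>_def \<gamma>_def wedge_def using wedge_nonzero
    by (auto simp: wedge_def intro!: continuous_intros)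
  show "continuous_on S \<alpha>"
    unfolding \<alpha>_def by (intro continuous_intros \<beta> \<gamma>)
qed

lemma negligible_coord_line:
  assumes "p \<noteq> 0 \<or> q \<noteq> 0"
  shows "negligible {x. p * \<beta> x + q * \<gamma> x = c}"
proof -
  define u v d where "u = B - A" and "v = C - A" and "d = wedge u v"
  define w :: "real^2" where "w = vector [p * v$2 - q * u$2, q * u$1 - p * v$1]"
  have d: "d \<noteq> 0"
    using wedge_nonzero by (simp add: d_def u_def v_def)
  have "p * \<beta> x + q * \<gamma> x = (p * wedge (x - A) v + q * wedge u (x - A)) / d" for x
    by (simp add: \<beta>_def \<gamma>_def d_def u_def v_def add_divide_distrib)
  moreover have "p * wedge (x - A) v + q * wedge u (x - A) = w \<bullet> x - w \<bullet> A" for x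
    by (simp add: w_def wedge_def inner_vec_def sum_2 vector_2 algebra_simps)
  ultimately have "p * \<beta> x + q * \<gamma> x = (w \<bullet> x - w \<bullet> A) / d" for x
    by simp
  then have "{x. p * \<beta> x + q * \<gamma> x = c} = {x. w \<bullet> x = c * d + w \<bullet> A}"
    using d by (simp add: divide_eq_eq diff_eq_eq)
  moreover have "w \<noteq> 0"
  proof
    assume "w = 0"
    then have "p * v$2 = q * u$2" "p * v$1 = q * u$1"
      by (simp_all add: w_def vec_eq_iff forall_2 vector_2)
    note eqs = this
    have "p * d = u$1 * (p * v$2) - u$2 * (p * v$1)"
      by (simp add: d_def wedge_def algebra_simps)
    then have "p * d = 0"
      unfolding eqs by simp
    have "q * d = v$2 * (q * u$1) - v$1 * (q * u$2)"
      by (simp add: d_def wedge_def algebra_simps)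
    then have "q * d = 0"
      unfolding eqs [symmetric] by simp
    with \<open>p * d = 0\<close> show False
      using assms d by simp
  qed
  ultimately show ?thesis
    by (simp add: negligible_hyperplane)
qed

lemma negligible_coord_lines:
  "negligible {x. \<alpha> x = c}" "negligible {x. \<beta> x = c}" "negligible {x. \<gamma> x = c}"
proof -
  have "{x. \<alpha> x = c} = {x. 1 * \<beta> x + 1 * \<gamma> x = 1 - c}"
    by (auto simp: \<alpha>_def)
  then show "negligible {x. \<alpha> x = c}"
    using negligible_coord_line [of 1 1 "1 - c"] by simp
  show "negligible {x. \<beta> x = c}" "negligible {x. \<gamma> x = c}"
    using negligible_coord_line [of 1 0 c] negligible_coord_line [of 0 1 c] by simp_all
qed

end

section \<open>The tile\<close>

locale golden_tile = equilateral_frame +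
  fixes t :: real
  assumes t_pos: "0 < t" and golden: "t + t\<^sup>2 \<le> 1"
begin

text \<open>\<^term>\<open>1 - p\<close> equals \<open>2 - 1/t\<close>, which is \<open>1/t\<close> times the side \<open>2 t - 1\<close> of the overlap
of the two corner triangles of side \<^term>\<open>t\<close> at \<^term>\<open>A\<close> and \<^term>\<open>B\<close> (lengths in units of
the side of \<open>ABC\<close>). It is negative for \<open>t < 1/2\<close>, when the corner triangles are apart;
the bounds by \<^term>\<open>p\<close> below then hold throughout the triangle.\<close>
abbreviation p :: real where
  "p \<equiv> (1 - t) / t"

text \<open>The vertices \<open>A, B, C\<close> are sent by \<^term>\<open>shrink True\<close> to the points dividing \<open>AB\<close> and \<open>AC\<close>
at distance \<^term>\<open>t\<close> from \<open>A\<close>, and to \<open>A\<close>; \<^term>\<open>shrink False\<close> sends them to the point of \<open>BA\<close>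
at distance \<^term>\<open>t\<close> from \<open>B\<close>, to the point of \<open>BC\<close> at that distance, and to \<open>B\<close>. The
orientation matters: the corner \<open>C\<close>, which the tile fills, goes to the outer corners
\<open>A\<close> and \<open>B\<close>, and the corner \<open>A\<close>, which the tile avoids, goes to the overlap in both cases.\<close>
primrec shrink :: "bool \<Rightarrow> real^2 \<Rightarrow> real^2" where
  "shrink True x = pt (1 - t + t * \<gamma> x) (t * \<alpha> x) (t * \<beta> x)"
| "shrink False x = pt (t * \<alpha> x) (1 - t + t * \<gamma> x) (t * \<beta> x)"

text \<open>Without its corners at \<open>A\<close> and \<open>B\<close>, the triangle is mapped neither into the overlap
nor into the intersections of the two corner triangles with the one of side \<^term>\<open>t\<close> at \<open>C\<close>.
Hence the interiors of its two images are disjoint from each other and from the corner triangle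
at \<open>C\<close>.\<close>
definition cut_triangle :: "(real^2) set" where
  "cut_triangle = {x \<in> convex hull {A, B, C}. \<alpha> x \<le> p \<and> \<beta> x \<le> p}"

text \<open>Solves \<open>tile = triangle - shrink True ` tile - shrink False ` tile\<close>, up to a null set, by unfolding
the equation twice: a point of the triangle outside both images of \<^term>\<open>cut_triangle\<close> can belong to
neither copy, and a point of a copy of a copy lies outside the copies. The side condition on \<open>\<gamma>\<close>
excludes the points near \<open>C\<close> that the first map sends into a removed corner. The second map would
send them on into one of the intersections of corner triangles, which the base rule already
gives to the tile.\<close>
inductive_set tile :: "(real^2) set" where
  base: "0 < \<alpha> x \<Longrightarrow> 0 < \<beta> x \<Longrightarrow> 0 < \<gamma> x \<Longrightarrow> (\<And>k. x \<notin> shrink k ` cut_triangle) \<Longrightarrow> x \<in> tile"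
| step: "z \<in> tile \<Longrightarrow> 1 - t + t * \<gamma> z < p \<Longrightarrow> shrink k (shrink l z) \<in> tile"

lemma coords_shrink [simp]:
  "\<alpha> (shrink True x) = 1 - t + t * \<gamma> x" "\<beta> (shrink True x) = t * \<alpha> x" "\<gamma> (shrink True x) = t * \<beta> x"
  "\<alpha> (shrink False x) = t * \<alpha> x" "\<beta> (shrink False x) = 1 - t + t * \<gamma> x" "\<gamma> (shrink False x) = t * \<beta> x"
proof -
  have "1 - t + t * \<gamma> x + t * \<alpha> x + t * \<beta> x = 1 - t + t * (\<alpha> x + \<beta> x + \<gamma> x)"
    by (simp add: distrib_left)
  then have "1 - t + t * \<gamma> x + t * \<alpha> x + t * \<beta> x = 1"
    by (simp add: sum_coords)
  then have "1 - t + t * \<gamma> x + t * \<alpha> x + t * \<beta> x = 1" "t * \<alpha> x + (1 - t + t * \<gamma> x) + t * \<beta> x = 1"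
    by simp_all
  from coords_pt [OF this(1)] coords_pt [OF this(2)]
  show "\<alpha> (shrink True x) = 1 - t + t * \<gamma> x" "\<beta> (shrink True x) = t * \<alpha> x" "\<gamma> (shrink True x) = t * \<beta> x"
    "\<alpha> (shrink False x) = t * \<alpha> x" "\<beta> (shrink False x) = 1 - t + t * \<gamma> x" "\<gamma> (shrink False x) = t * \<beta> x"
    by simp_all
qed

declare shrink.simps [simp del]

lemma dist_shrink: "dist (shrink k x) (shrink k y) = t * dist x y"
proof -
  have "(dist (shrink k x) (shrink k y))\<^sup>2 = (t * dist x y)\<^sup>2"
    unfolding power_mult_distrib dist_coords
    by (cases k) (simp_all add: power2_eq_square algebra_simps)
  then show ?thesis
    using t_pos by (simp add: power2_eq_iff_nonneg)
qed

lemma similarity_shrink: "similarity (shrink k)"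
  unfolding similarity_def using t_pos dist_shrink by blast

lemma shrink_eq_iff [simp]: "shrink k x = shrink k y \<longleftrightarrow> x = y"
  using dist_shrink [of k x y] t_pos by (metis dist_eq_0_iff mult_eq_0_iff less_irrefl)

lemma t_less_1: "t < 1"
  using golden t_pos by (smt (verit) zero_less_power)

lemma t_le_p: "t \<le> p"
  using golden t_pos by (simp add: field_simps power2_eq_square)

lemma t_p: "t * p = 1 - t"
  using t_pos by simp

text \<open>Together with \<open>t \<le> p\<close>, the form in which the bound by the golden ratio is used to keep points out of
the removed corners.\<close>
lemma one_minus_t2_le_p: "1 - t\<^sup>2 \<le> p"
proof -
  have "(1 - t) * (t + t\<^sup>2) \<le> (1 - t) * 1"
    using golden t_less_1 by (intro mult_left_mono) auto
  then show ?thesis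
    using t_pos by (simp add: field_simps power2_eq_square)
qed

lemma open_frame: "open {x. 0 < \<alpha> x \<and> 0 < \<beta> x \<and> 0 < \<gamma> x}"
  by (intro open_Collect_conj open_Collect_less continuous_intros)

lemma shrink_image_cut_triangle_iff:
  "x \<in> shrink True ` cut_triangle \<longleftrightarrow> 1 - t \<le> \<alpha> x \<and> 0 \<le> \<beta> x \<and> \<beta> x \<le> 1 - t \<and> 0 \<le> \<gamma> x \<and> \<gamma> x \<le> 1 - t" (is ?T)
  "x \<in> shrink False ` cut_triangle \<longleftrightarrow> 1 - t \<le> \<beta> x \<and> 0 \<le> \<alpha> x \<and> \<alpha> x \<le> 1 - t \<and> 0 \<le> \<gamma> x \<and> \<gamma> x \<le> 1 - t" (is ?F)
proof -
  have le: "t * a \<le> 1 - t \<longleftrightarrow> a \<le> p" for a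
    using t_pos by (simp add: field_simps)
  have mem_cut: "y \<in> cut_triangle \<longleftrightarrow> 0 \<le> \<alpha> y \<and> 0 \<le> \<beta> y \<and> 0 \<le> \<gamma> y \<and> t * \<alpha> y \<le> 1 - t \<and> t * \<beta> y \<le> 1 - t" for y
    by (auto simp: cut_triangle_def triangle_coords le)
  have nn: "0 \<le> t * a \<longleftrightarrow> 0 \<le> a" for a
    using t_pos by (simp add: zero_le_mult_iff)
  have surj: "\<exists>y. x = shrink k y" for k
    using similarity_bij [OF similarity_shrink] by (metis bij_pointE)
  obtain y where y: "x = shrink True y"
    using surj by blast
  then have "x \<in> shrink True ` cut_triangle \<longleftrightarrow> y \<in> cut_triangle"
    by auto
  then show ?T
    unfolding y mem_cut using nn by auto
  obtain y where y: "x = shrink False y"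
    using surj by blast
  then have "x \<in> shrink False ` cut_triangle \<longleftrightarrow> y \<in> cut_triangle"
    by auto
  then show ?F
    unfolding y mem_cut using nn by auto
qed

text \<open>The base rule produces no point of a removed corner, since this corner is the image of a triangle
at \<open>C\<close> of side at most \<^term>\<open>t\<close>, which \<^term>\<open>cut_triangle\<close> contains. Second-generation points satisfy \<open>\<gamma> < 1 - t\<close> after the first map,
which keeps them out of the corner after the second one.\<close>
lemma tile_bounds:
  assumes "x \<in> tile"
  shows "0 < \<alpha> x \<and> 0 < \<beta> x \<and> 0 < \<gamma> x \<and> \<alpha> x < p \<and> \<beta> x < p"
  using assms
proof induction
  case (base x)
  have "1 - t \<le> 1 - t\<^sup>2" "1 - p \<le> 1 - t"
    using t_le_p t_pos t_less_1 by (simp_all add: power2_eq_square mult_left_le)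
  moreover have "1 - p \<le> t\<^sup>2" 
    using one_minus_t2_le_p by simp
  moreover have "t\<^sup>2 \<le> 1 - t"
    using golden by simp
  moreover have "x \<notin> shrink True ` cut_triangle" "x \<notin> shrink False ` cut_triangle"
    by (rule base)+
  ultimately show ?case
    using base(1-3) sum_coords [of x] one_minus_t2_le_p unfolding shrink_image_cut_triangle_iff by linarith
next
  case (step z k l)
  define w where "w = shrink l z"
  have z: "\<alpha> z < 1" "\<beta> z < 1" "\<gamma> z < 1" "t * \<beta> z < 1 - t"
    using step(3) sum_coords [of z] t_p mult_strict_left_mono [of "\<beta> z" p t] t_pos by auto
  have w: "0 < \<alpha> w" "0 < \<beta> w" "0 < \<gamma> w" "\<gamma> w < 1 - t"
    unfolding w_def using z step(3) t_pos t_less_1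
    by (cases l; simp add: add_pos_pos)+
  then have "t * \<alpha> w < t"
    using sum_coords [of w] t_pos by simp
  then have w1: "t * \<alpha> w < p"
    using t_le_p by (rule less_le_trans)
  have "t * \<gamma> w < t * (1 - t)"
    using w t_pos by simp
  then have "1 - t + t * \<gamma> w < p"
    using one_minus_t2_le_p by (simp add: power2_eq_square algebra_simps)
  then show ?case
    unfolding w_def [symmetric] using w w1 t_pos t_less_1
    by (cases k) (auto intro!: add_pos_pos)
qed

lemma tile_subset_cut_triangle: "tile \<subseteq> cut_triangle"
  using tile_bounds by (force simp: cut_triangle_def triangle_coords)

text \<open>The line \<open>\<beta> = 1 - t\<close> separates the two images: \<open>\<alpha> < p\<close> puts the first one strictly below it
because \<open>t p = 1 - t\<close>, and \<open>\<gamma> > 0\<close> puts the second one strictly above.\<close>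
lemma shrink_images_disjoint:
  assumes "shrink k x = shrink l y" "\<alpha> x < p" "0 < \<gamma> x" "\<alpha> y < p" "0 < \<gamma> y"
  shows "k = l"
proof -
  have less: "t * a < 1 - t" if "a < p" for a
    using that t_p t_pos by (metis mult_strict_left_mono)
  have "0 < t * \<gamma> x" "0 < t * \<gamma> y"
    using assms t_pos by simp_all
  then show ?thesis
    using assms(1) less [OF assms(2)] less [OF assms(4)]
      coords_shrink(2) [of x] coords_shrink(5) [of x] coords_shrink(2) [of y] coords_shrink(5) [of y]
    by (cases k; cases l) auto
qed

lemma open_tile: "open tile"
proof -
  have "tile \<subseteq> interior tile"
  proof
    fix x assume "x \<in> tile"
    then show "x \<in> interior tile"
    proof induction
      case (base x)
      have "closed cut_triangle"
      proof -
        have "cut_triangle = {x. 0 \<le> \<alpha> x} \<inter> {x. 0 \<le> \<beta> x} \<inter> {x. 0 \<le> \<gamma> x} \<inter> {x. \<alpha> x \<le> p} \<inter> {x. \<beta> x \<le> p}"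
          by (auto simp: cut_triangle_def triangle_coords)
        then show ?thesis
          by (simp only:) (intro closed_Int closed_Collect_le continuous_intros)
      qed
      then have "closed (shrink k ` cut_triangle)" for k
        using closure_similarity_image [OF similarity_shrink] by (metis closure_closed closed_closure)
      then have "open ({x. 0 < \<alpha> x \<and> 0 < \<beta> x \<and> 0 < \<gamma> x} - shrink True ` cut_triangle - shrink False ` cut_triangle)"
        by (intro open_Diff open_frame)
      moreover have "{x. 0 < \<alpha> x \<and> 0 < \<beta> x \<and> 0 < \<gamma> x} - shrink True ` cut_triangle - shrink False ` cut_triangle \<subseteq> tile"
      proof
        fix y assume "y \<in> {x. 0 < \<alpha> x \<and> 0 < \<beta> x \<and> 0 < \<gamma> x} - shrink True ` cut_triangle - shrink False ` cut_triangle"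
        then have y: "0 < \<alpha> y" "0 < \<beta> y" "0 < \<gamma> y" "y \<notin> shrink k ` cut_triangle" for k
          by (cases k; simp)+
        show "y \<in> tile"
          by (rule tile.base [OF y])
      qed
      ultimately show ?case
        using base by (intro interiorI) auto
    next
      case (step z k l)
      define W where "W = interior tile \<inter> {z. 1 - t + t * \<gamma> z < p}"
      have "open (shrink k ` shrink l ` W)"
        unfolding W_def
        by (intro open_similarity_image similarity_shrink open_Int open_interior open_Collect_less continuous_intros)
      moreover have "shrink k ` shrink l ` W \<subseteq> tile"
        unfolding W_def using interior_subset by (auto intro!: tile.step)
      moreover have "shrink k (shrink l z) \<in> shrink k ` shrink l ` W"
        using step by (auto simp: W_def)
      ultimately show ?case
        by (meson interiorI)
    qed
  qed
  then show ?thesis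
    by (metis interior_subset open_interior subset_antisym)
qed

text \<open>The side condition of the step rule, seen as a statement about the intermediate point. It allows
\<open>shrink_images_disjoint\<close> to recover the outer map of a second-generation point, even
though the intermediate point is not in the tile.\<close>
lemma shrink_in_cut_triangle:
  assumes "z \<in> tile" "1 - t + t * \<gamma> z < p"
  shows "\<alpha> (shrink l z) < p" "\<beta> (shrink l z) < p" "0 < \<gamma> (shrink l z)"
proof -
  have "t * \<alpha> z < t"
    using tile_bounds [OF assms(1)] sum_coords [of z] t_pos by simp
  then have a: "t * \<alpha> z < p"
    using t_le_p by (rule less_le_trans)
  have "0 < t * \<beta> z"
    using tile_bounds [OF assms(1)] t_pos by simp
  with a assms(2) show "\<alpha> (shrink l z) < p" "\<beta> (shrink l z) < p" "0 < \<gamma> (shrink l z)"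
    by (cases l; simp only: coords_shrink)+
qed

text \<open>If a second-generation point were in a copy of the tile, cancelling its outer map would put the
intermediate point in the tile. That point is itself the image of a tile point, so it must be of the
second generation too, and cancelling once more contradicts the induction hypothesis.\<close>
lemma tile_disjoint_shrink_tile:
  assumes "x \<in> tile"
  shows "x \<notin> shrink k ` tile"
  using assms
proof (induction arbitrary: k)
  case (base x)
  then show ?case
    using tile_subset_cut_triangle by blast
next
  case (step z i j)
  show ?case
  proof
    assume "shrink i (shrink j z) \<in> shrink k ` tile"
    then obtain y where y: "shrink i (shrink j z) = shrink k y" "y \<in> tile"
      by blast
    note inner = shrink_in_cut_triangle [OF step.hyps] and IH = step.IH and z = step.hyps(1)
    have "i = k"
      using shrink_images_disjoint [OF y(1)] inner tile_bounds [OF y(2)] by blast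
    with y have "shrink j z \<in> tile"
      by simp
    then show False
    proof cases
      case base
      then show False
        using z tile_subset_cut_triangle by blast
    next
      case (step z' m n)
      note inner' = shrink_in_cut_triangle [OF step(2,3)]
      have "j = m"
        using shrink_images_disjoint [OF step(1)] inner' tile_bounds [OF z] by blast
      with step have "z \<in> shrink n ` tile"
        by simp
      then show False
        using IH by blast
    qed
  qed
qed

lemma shrunk_tiles_disjoint: "shrink True ` tile \<inter> shrink False ` tile = {}"
proof (rule ccontr)
  assume "shrink True ` tile \<inter> shrink False ` tile \<noteq> {}"
  then obtain x y where "shrink True x = shrink False y" "x \<in> tile" "y \<in> tile"
    by (auto simp: image_iff)
  then show False
    using shrink_images_disjoint [of True x False y] tile_bounds by blast
qed

lemma shrink_tile_subset: "shrink k ` tile \<subseteq> convex hull {A, B, C}"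
proof
  fix x assume "x \<in> shrink k ` tile"
  then obtain y where "x = shrink k y" "y \<in> tile"
    by blast
  then show "x \<in> convex hull {A, B, C}"
    using tile_bounds [of y] t_pos t_less_1 by (cases k) (auto simp: triangle_coords intro!: add_nonneg_nonneg)
qed

text \<open>The gap \<open>N\<close> reproduces itself: outside finitely many lines, every point of \<open>N\<close> is the image of a point
of \<open>N\<close> under one of the two maps. Hence its area is at most \<open>2 t\<^sup>2\<close> times itself, and \<open>2 t\<^sup>2 < 1\<close>.\<close>
lemma negligible_gap: "negligible (convex hull {A, B, C} - (tile \<union> shrink True ` tile \<union> shrink False ` tile))"
proof -
  define D where "D = convex hull {A, B, C}"
  define N where "N = D - (tile \<union> shrink True ` tile \<union> shrink False ` tile)"
  define L where "L = (\<Union>c\<in>{0, 1 - t}. {x. \<alpha> x = c} \<union> {x. \<beta> x = c} \<union> {x. \<gamma> x = c})"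
  have "negligible L"
    by (auto simp: L_def negligible_coord_lines intro!: negligible_Un)
  have cover: "N \<subseteq> L \<union> shrink True ` N \<union> shrink False ` N"
  proof
    fix x assume x: "x \<in> N"
    show "x \<in> L \<union> shrink True ` N \<union> shrink False ` N"
    proof (cases "x \<in> L")
      case False
      then have "0 < \<alpha> x" "0 < \<beta> x" "0 < \<gamma> x"
        using x by (auto simp: N_def D_def L_def triangle_coords order.order_iff_strict)
      moreover have "x \<notin> tile"
        using x by (simp add: N_def)
      ultimately obtain k where "x \<in> shrink k ` cut_triangle"
        using base by blast
      then obtain y where y: "x = shrink k y" "y \<in> cut_triangle"
        by blast
      have "y \<notin> tile"
        using x y(1) by (cases k) (auto simp: N_def)
      moreover have "y \<notin> shrink l ` tile" for l
      proof
        assume "y \<in> shrink l ` tile"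
        then obtain z where z: "y = shrink l z" "z \<in> tile"
          by blast
        have "\<not> 1 - t + t * \<gamma> z < p"
          using step [OF z(2), of k l] x y(1) z(1) by (auto simp: N_def)
        \<comment> \<open>The side condition can fail for a point mapped into \<^term>\<open>cut_triangle\<close> only on its cut edges.\<close>
        then have "\<alpha> y = p \<or> \<beta> y = p"
          using y(2) unfolding z(1) by (cases l) (auto simp: cut_triangle_def)
        then show False
          using False t_p y(1) by (cases k) (auto simp: L_def)
      qed
      moreover have "y \<in> D"
        using y(2) by (simp add: cut_triangle_def D_def)
      ultimately have "y \<in> N"
        by (simp add: N_def)
      then show ?thesis
        using y(1) by (cases k) auto
    qed auto
  qed
  have "compact D"
    unfolding D_def by (simp add: finite_imp_compact_convex_hull)
  moreover have "open (tile \<union> shrink True ` tile \<union> shrink False ` tile)"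
    by (intro open_Un open_tile open_similarity_image similarity_shrink)
  ultimately have "compact N"
    unfolding N_def by (rule compact_diff)
  then have N: "N \<in> lmeasurable"
    by (rule lmeasurable_compact)
  have shrink_N: "shrink k ` N \<in> lmeasurable" "measure lebesgue (shrink k ` N) = t\<^sup>2 * measure lebesgue N" for k
    using lmeasurable_similarity_image [OF t_pos dist_shrink N] measure_similarity_image [OF t_pos dist_shrink N]
    by simp_all
  have L: "L \<in> lmeasurable" "measure lebesgue L = 0"
    using \<open>negligible L\<close> by (simp_all add: negligible_iff_measure)
  have "measure lebesgue N \<le> measure lebesgue (L \<union> shrink True ` N \<union> shrink False ` N)"
    using N L shrink_N cover by (intro measure_mono_fmeasurable fmeasurable.Un) auto
  also have "\<dots> \<le> measure lebesgue (L \<union> shrink True ` N) + measure lebesgue (shrink False ` N)"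
    using L shrink_N by (intro measure_Un_le) auto
  also have "\<dots> \<le> measure lebesgue L + measure lebesgue (shrink True ` N) + measure lebesgue (shrink False ` N)"
    using L shrink_N by (intro add_right_mono measure_Un_le) auto
  finally have *: "measure lebesgue N \<le> 2 * t\<^sup>2 * measure lebesgue N"
    by (simp add: L shrink_N algebra_simps)
  have "2 * t\<^sup>2 < 1"
  proof (cases "t \<le> 7 / 10")
    case True
    then have "t\<^sup>2 \<le> (7 / 10)\<^sup>2"
      using t_pos by (intro power_mono) auto
    then show ?thesis
      by (simp add: power2_eq_square)
  next
    case False
    then show ?thesis
      using golden by linarith
  qed
  have "measure lebesgue N = 0"
  proof (rule ccontr)
    assume "measure lebesgue N \<noteq> 0"
    then have "0 < measure lebesgue N"
      by (simp add: zero_less_measure_iff)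
    then have "2 * t\<^sup>2 * measure lebesgue N < 1 * measure lebesgue N"
      using \<open>2 * t\<^sup>2 < 1\<close> by (intro mult_strict_right_mono)
    with * show False
      by simp
  qed
  then show ?thesis
    using N by (simp add: negligible_iff_measure N_def D_def)
qed

lemma triangle_regular: "convex hull {A, B, C} \<subseteq> closure (interior (convex hull {A, B, C}))"
proof -
  have "{x. 0 < \<alpha> x \<and> 0 < \<beta> x \<and> 0 < \<gamma> x} \<subseteq> convex hull {A, B, C}"
    by (auto simp: triangle_coords)
  then have "{x. 0 < \<alpha> x \<and> 0 < \<beta> x \<and> 0 < \<gamma> x} \<subseteq> interior (convex hull {A, B, C})"
    by (simp add: interior_maximal open_frame)
  moreover have "pt (1/3) (1/3) (1/3) \<in> {x. 0 < \<alpha> x \<and> 0 < \<beta> x \<and> 0 < \<gamma> x}"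
    by simp
  ultimately have "interior (convex hull {A, B, C}) \<noteq> {}"
    by blast
  then show ?thesis
    by (simp add: convex_closure_interior closure_subset)
qed

end

section \<open>Dissections with area ratio \<open>1 : 1 : a\<close>\<close>

theorem mainTheorem1:
  fixes D :: "(real ^ 2) set" and a :: real
  assumes "equilateral_triangle D"
    and "a \<ge> (3 + sqrt 5) / 2"
  shows "\<exists>X :: nat \<Rightarrow> (real ^ 2) set.
           (\<forall>i\<in>{1,2,3}. compact (X i) \<and> closure (interior (X i)) = X i) \<and>
           pairwise (\<lambda>i j. similar_sets (X i) (X j)) {1,2,3} \<and>
           D = X 1 \<union> X 2 \<union> X 3 \<and>
           pairwise (\<lambda>i j. emeasure lebesgue (X i \<inter> X j) = 0) {1,2,3} \<and>
           measure lebesgue (X 1) = measure lebesgue (X 2) \<and>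
           measure lebesgue (X 3) = a * measure lebesgue (X 1)"
proof -
  obtain A B C where ABC: "A \<noteq> B" "dist A B = dist B C" "dist B C = dist C A"
    and D: "D = convex hull {A, B, C}"
    using assms(1) by (auto simp: equilateral_triangle_def)
  define t where "t = 1 / sqrt a"
  have "a > 0"
    using assms(2) by (smt (verit) divide_pos_pos real_sqrt_ge_zero)
  have t: "0 < t" "t\<^sup>2 = 1 / a"
    using \<open>a > 0\<close> by (simp_all add: t_def power_divide)
  have "t + t\<^sup>2 \<le> 1"
  proof -
    define \<phi> where "\<phi> = (1 + sqrt 5) / 2"
    have phi: "\<phi>\<^sup>2 = (3 + sqrt 5) / 2" "1 < \<phi>"
      by (simp_all add: \<phi>_def power2_eq_square field_simps)
    then have ge: "\<phi> \<le> sqrt a"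
      using assms(2) by (intro real_le_rsqrt) simp
    have "(sqrt a)\<^sup>2 - sqrt a - 1 = (sqrt a - \<phi>) * (sqrt a + \<phi> - 1) + (\<phi>\<^sup>2 - \<phi> - 1)"
      by (simp add: power2_eq_square algebra_simps)
    moreover have "\<phi>\<^sup>2 - \<phi> - 1 = 0"
      unfolding phi by (simp add: \<phi>_def field_simps)
    moreover have "0 \<le> (sqrt a - \<phi>) * (sqrt a + \<phi> - 1)"
      using ge phi by (intro mult_nonneg_nonneg) auto
    ultimately have "sqrt a + 1 \<le> (sqrt a)\<^sup>2"
      by linarith
    moreover have "t = sqrt a / a"
      using \<open>a > 0\<close> by (simp add: t_def real_div_sqrt field_simps)
    ultimately show ?thesis
      using \<open>a > 0\<close> unfolding t(2) by (simp add: field_simps)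
  qed
  then interpret golden_tile A B C "dist A B" t
    using ABC t by unfold_locales auto
  define V where "V i = (if i = 1 then shrink True ` tile else if i = 2 then shrink False ` tile else tile)" for i :: nat
  have V: "V 1 = shrink True ` tile" "V (Suc 0) = shrink True ` tile" "V 2 = shrink False ` tile" "V 3 = tile"
    by (simp_all add: V_def)
  define X where "X i = closure (V i)" for i
  have opn: "open (V i)" for i
    by (simp add: V_def open_tile open_similarity_image similarity_shrink)
  have sub: "V i \<subseteq> D" for i
    using shrink_tile_subset tile_subset_cut_triangle by (auto simp: V_def D cut_triangle_def)
  have disj: "disjoint_family_on V {1, 2, 3}"
    using tile_disjoint_shrink_tile shrunk_tiles_disjoint by (auto simp: disjoint_family_on_def V)
  have D': "closed D" "D \<subseteq> closure (interior D)" "bounded D"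
    using triangle_regular by (simp_all add: D finite_imp_bounded_convex_hull finite_imp_compact_convex_hull compact_imp_closed)
  have "negligible (D - (\<Union>i\<in>{1, 2, 3}. V i))"
    using negligible_gap by (simp add: D V Un_ac)
  note dissection = dissection_by_closures [OF _ D'(1,2) opn sub disj this]
  have comp: "compact (X i)" for i
    unfolding X_def using bounded_subset [OF D'(3) sub] by (simp add: compact_closure)
  have reg: "closure (interior (X i)) = X i" for i
  proof
    show "closure (interior (X i)) \<subseteq> X i"
      by (simp add: X_def closure_minimal interior_subset)
    show "X i \<subseteq> closure (interior (X i))"
      unfolding X_def by (intro closure_mono interior_maximal closure_subset opn)
  qed
  have img: "X 1 = shrink True ` X 3" "X 2 = shrink False ` X 3"
    by (simp_all add: X_def V closure_similarity_image similarity_shrink)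
  have sim: "similar_sets (X 3) (X 1)" "similar_sets (X 3) (X 2)"
    unfolding similar_sets_def using img similarity_shrink by blast+
  have lm: "X 3 \<in> lmeasurable"
    by (simp add: comp lmeasurable_compact)
  have meas: "measure lebesgue (shrink k ` X 3) = t\<^sup>2 * measure lebesgue (X 3)" for k
    using measure_similarity_image [OF t_pos dist_shrink lm] by simp
  show ?thesis
  proof (intro exI [of _ X] conjI ballI)
    show "pairwise (\<lambda>i j. similar_sets (X i) (X j)) {1, 2, 3}"
      using sim similar_sets_sym similar_sets_trans by (auto simp: pairwise_insert) blast+
    show "D = X 1 \<union> X 2 \<union> X 3"
      using dissection(1) by (simp add: X_def Un_ac)
    show "pairwise (\<lambda>i j. emeasure lebesgue (X i \<inter> X j) = 0) {1, 2, 3}"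
      using dissection(2) unfolding X_def negligible_iff_emeasure0
      by (auto simp: pairwise_def negligible_iff_null_sets null_sets_def)
    show "measure lebesgue (X 1) = measure lebesgue (X 2)"
      unfolding img meas ..
    show "measure lebesgue (X 3) = a * measure lebesgue (X 1)"
      unfolding img meas using \<open>a > 0\<close> by (simp add: t)
  qed (use comp reg in auto)
qed

end
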